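(* Let $(A,\nearrow,\searrow,\swarrow,\nwarrow)$ be a pre-dialgebra and $(A,\rhd,\lhd)$ be its sub-adjacent dialgebra. Let $\{e_1,\ldots,e_n\}$ be a basis of $A$ and $\{e_1^*,\ldots,e_n^*\}$ be the dual basis. Then $$r=\sum_{i=1}^n\big(e_i\otimes e_i^*+e_i^*\otimes e_i\big)$$ is a symmetric solution of the diassociative Yang-Baxter equation (DAYBE) in the dialgebra $\hat A=A\oplus A^*$ with products (for $x,y\in A$, $a^*,b^*\in A^*$) $$(x+a^* )\rhd(y+b^* )=x\rhd y-R_{\nwarrow}^*(x)b^*+(-L_{\nearrow}^*+L_{\swarrow}^* )(y)a^*,$$ $$(x+a^* )\lhd(y+b^* )=x\lhd y+(R_{\searrow}^*-R_{\nwarrow}^* )(x)b^*-L_{\nearrow}^*(y)a^*.$$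
   Context: All vector spaces and algebras are finite-dimensional over a field $\mathbb F$ of characteristic $0$; algebras are not assumed unital. A dialgebra is $(A,\rhd,\lhd)$ where $\rhd,\lhd$ are associative bilinear products with $(x\lhd y)\lhd z=x\lhd(y\rhd z)$, $(x\rhd y)\lhd z=x\rhd(y\lhd z)$, $(x\lhd y)\rhd z=x\rhd(y\rhd z)$. A dendriform algebra $(A,\vdash,\dashv)$ is a vector space with two bilinear products satisfying $x\vdash(y\vdash z)=(x\vdash y+x\dashv y)\vdash z$, $x\vdash(y\dashv z)=(x\vdash y)\dashv z$, $(x\dashv y)\dashv z=x\dashv(y\vdash z+y\dashv z)$. A pre-dialgebra is $(A,\nearrow,\searrow,\swarrow,\nwarrow)$ such that $(A,\nearrow,\searrow)$ (with $\vdash=\nearrow$, $\dashv=\searrow$) and $(A,\swarrow,\nwarrow)$ (with $\vdash=\swarrow$, $\dashv=\nwarrow$) are dendriform algebras and, setting $x\rhd y=x\nearrow y+x\searrow y$, $x\lhd y=x\swarrow y+x\nwarrow y$, for all $x,y,z\in A$: $x\nwarrow(y\lhd z)=x\nwarrow(y\rhd z)$, $x\swarrow(y\nwarrow z)=x\swarrow(y\searrow z)$, $x\swarrow(y\swarrow z)=x\swarrow(y\nearrow z)$, $(x\searrow y)\nwarrow z=x\searrow(y\lhd z)$, $(x\nearrow y)\nwarrow z=x\nearrow(y\nwarrow z)$, $(x\rhd y)\swarrow z=x\nearrow(y\swarrow z)$, $(x\nwarrow y)\searrow z=(x\searrow y)\searrow z$, $(x\swarrow y)\searrow z=(x\nearrow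 y)\searrow z$, $(x\lhd y)\nearrow z=(x\rhd y)\nearrow z$. Then $(A,\rhd,\lhd)$ is a dialgebra, called the sub-adjacent dialgebra of the pre-dialgebra. Notation: $L_\diamond(x)y=x\diamond y=R_\diamond(y)x$; for linear $\varphi:A\to\mathrm{End}(V)$, $\varphi^*:A\to\mathrm{End}(V^* )$ is given by $\langle\varphi^*(x)v^*,u\rangle=-\langle v^*,\varphi(x)u\rangle$ (note the sign). For a dialgebra $(D,\rhd,\lhd)$ with $x\star y=x\rhd y-x\lhd y$, an element $r=\sum_i a_i\otimes b_i\in D\otimes D$ is a solution of the DAYBE if $\sum_{i,j}\big(a_i\otimes a_j\otimes b_i\rhd b_j-a_j\otimes a_i\lhd b_j\otimes b_i-a_i\star a_j\otimes b_i\otimes b_j\big)=0$ in $D\otimes D\otimes D$; it is symmetric if $\tau(r)=r$, $\tau(x\otimes y)=y\otimes x$. *)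

theory Defs
  imports
    Complex_Main
    "HOL-Library.Function_Algebras"
    "HOL-Library.Product_Plus"
    "HOL-Library.Poly_Mapping"
begin

text \<open>
  A vector space is a subspace \<open>V\<close> of an ambient type carrying a \<open>vector_space\<close> structure. A carrier
  set is needed because the linear functionals form a proper subspace of the type of all functions.
\<close>

locale fin_dim_space = vector_space scale
  for scale :: "'k::field_char_0 \<Rightarrow> 'v::ab_group_add \<Rightarrow> 'v" +
  fixes V :: "'v set"
  assumes subspace_carrier: "subspace V"
    and fin_dim_carrier: "\<exists>B. finite B \<and> span B = V"

definition bilinear_product ::
  "('k \<Rightarrow> 'v \<Rightarrow> 'v::ab_group_add) \<Rightarrow> 'v set \<Rightarrow> ('v \<Rightarrow> 'v \<Rightarrow> 'v) \<Rightarrow> bool" where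
  "bilinear_product scale V f \<longleftrightarrow>
     (\<forall>x\<in>V. \<forall>y\<in>V. f x y \<in> V) \<and>
     (\<forall>x\<in>V. \<forall>y\<in>V. \<forall>z\<in>V. f (x + y) z = f x z + f y z) \<and>
     (\<forall>x\<in>V. \<forall>y\<in>V. \<forall>z\<in>V. f x (y + z) = f x y + f x z) \<and>
     (\<forall>c. \<forall>x\<in>V. \<forall>y\<in>V. f (scale c x) y = scale c (f x y)) \<and>
     (\<forall>c. \<forall>x\<in>V. \<forall>y\<in>V. f x (scale c y) = scale c (f x y))"

definition sum_product :: "('v \<Rightarrow> 'v \<Rightarrow> 'v::plus) \<Rightarrow> ('v \<Rightarrow> 'v \<Rightarrow> 'v) \<Rightarrow> 'v \<Rightarrow> 'v \<Rightarrow> 'v" where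
  "sum_product f g x y = f x y + g x y"

locale dialgebra = fin_dim_space scale V
  for scale :: "'k::field_char_0 \<Rightarrow> 'v::ab_group_add \<Rightarrow> 'v" and V +
  fixes rhd :: "'v \<Rightarrow> 'v \<Rightarrow> 'v" (infixl "\<rhd>" 70)
    and lhd :: "'v \<Rightarrow> 'v \<Rightarrow> 'v" (infixl "\<lhd>" 70)
  assumes bilinear_rhd: "bilinear_product scale V (\<rhd>)"
    and bilinear_lhd: "bilinear_product scale V (\<lhd>)"
    and assoc_rhd: "\<lbrakk>x \<in> V; y \<in> V; z \<in> V\<rbrakk> \<Longrightarrow> (x \<rhd> y) \<rhd> z = x \<rhd> (y \<rhd> z)"
    and assoc_lhd: "\<lbrakk>x \<in> V; y \<in> V; z \<in> V\<rbrakk> \<Longrightarrow> (x \<lhd> y) \<lhd> z = x \<lhd> (y \<lhd> z)"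
    and lhd_lhd: "\<lbrakk>x \<in> V; y \<in> V; z \<in> V\<rbrakk> \<Longrightarrow> (x \<lhd> y) \<lhd> z = x \<lhd> (y \<rhd> z)"
    and rhd_lhd: "\<lbrakk>x \<in> V; y \<in> V; z \<in> V\<rbrakk> \<Longrightarrow> (x \<rhd> y) \<lhd> z = x \<rhd> (y \<lhd> z)"
    and lhd_rhd: "\<lbrakk>x \<in> V; y \<in> V; z \<in> V\<rbrakk> \<Longrightarrow> (x \<lhd> y) \<rhd> z = x \<rhd> (y \<rhd> z)"

locale dendriform_algebra = fin_dim_space scale V
  for scale :: "'k::field_char_0 \<Rightarrow> 'v::ab_group_add \<Rightarrow> 'v" and V +
  fixes vd :: "'v \<Rightarrow> 'v \<Rightarrow> 'v" (infixl "\<turnstile>\<^sub>d" 70)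
    and dv :: "'v \<Rightarrow> 'v \<Rightarrow> 'v" (infixl "\<stileturn>\<^sub>d" 70)
  assumes bilinear_vd: "bilinear_product scale V (\<turnstile>\<^sub>d)"
    and bilinear_dv: "bilinear_product scale V (\<stileturn>\<^sub>d)"
    and vd_vd: "\<lbrakk>x \<in> V; y \<in> V; z \<in> V\<rbrakk> \<Longrightarrow> x \<turnstile>\<^sub>d (y \<turnstile>\<^sub>d z) = (x \<turnstile>\<^sub>d y + x \<stileturn>\<^sub>d y) \<turnstile>\<^sub>d z"
    and vd_dv: "\<lbrakk>x \<in> V; y \<in> V; z \<in> V\<rbrakk> \<Longrightarrow> x \<turnstile>\<^sub>d (y \<stileturn>\<^sub>d z) = (x \<turnstile>\<^sub>d y) \<stileturn>\<^sub>d z"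
    and dv_dv: "\<lbrakk>x \<in> V; y \<in> V; z \<in> V\<rbrakk> \<Longrightarrow> (x \<stileturn>\<^sub>d y) \<stileturn>\<^sub>d z = x \<stileturn>\<^sub>d (y \<turnstile>\<^sub>d z + y \<stileturn>\<^sub>d z)"

text \<open>
  \<open>sum_product ne se\<close> and \<open>sum_product sw nw\<close> are the products \<open>\<rhd>\<close> and \<open>\<lhd>\<close> of the sub-adjacent dialgebra.
\<close>

locale pre_dialgebra =
  upper: dendriform_algebra scale V ne se + lower: dendriform_algebra scale V sw nw
  for scale :: "'k::field_char_0 \<Rightarrow> 'v::ab_group_add \<Rightarrow> 'v" and V
    and ne :: "'v \<Rightarrow> 'v \<Rightarrow> 'v" (infixl "\<nearrow>" 70)
    and se :: "'v \<Rightarrow> 'v \<Rightarrow> 'v" (infixl "\<searrow>" 70)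
    and sw :: "'v \<Rightarrow> 'v \<Rightarrow> 'v" (infixl "\<swarrow>" 70)
    and nw :: "'v \<Rightarrow> 'v \<Rightarrow> 'v" (infixl "\<nwarrow>" 70) +
  assumes nw_lhd: "\<lbrakk>x \<in> V; y \<in> V; z \<in> V\<rbrakk> \<Longrightarrow> x \<nwarrow> sum_product sw nw y z = x \<nwarrow> sum_product ne se y z"
    and sw_nw: "\<lbrakk>x \<in> V; y \<in> V; z \<in> V\<rbrakk> \<Longrightarrow> x \<swarrow> (y \<nwarrow> z) = x \<swarrow> (y \<searrow> z)"
    and sw_sw: "\<lbrakk>x \<in> V; y \<in> V; z \<in> V\<rbrakk> \<Longrightarrow> x \<swarrow> (y \<swarrow> z) = x \<swarrow> (y \<nearrow> z)"
    and se_nw: "\<lbrakk>x \<in> V; y \<in> V; z \<in> V\<rbrakk> \<Longrightarrow> (x \<searrow> y) \<nwarrow> z = x \<searrow> sum_product sw nw y z"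
    and ne_nw: "\<lbrakk>x \<in> V; y \<in> V; z \<in> V\<rbrakk> \<Longrightarrow> (x \<nearrow> y) \<nwarrow> z = x \<nearrow> (y \<nwarrow> z)"
    and rhd_sw: "\<lbrakk>x \<in> V; y \<in> V; z \<in> V\<rbrakk> \<Longrightarrow> sum_product ne se x y \<swarrow> z = x \<nearrow> (y \<swarrow> z)"
    and nw_se: "\<lbrakk>x \<in> V; y \<in> V; z \<in> V\<rbrakk> \<Longrightarrow> (x \<nwarrow> y) \<searrow> z = (x \<searrow> y) \<searrow> z"
    and sw_se: "\<lbrakk>x \<in> V; y \<in> V; z \<in> V\<rbrakk> \<Longrightarrow> (x \<swarrow> y) \<searrow> z = (x \<nearrow> y) \<searrow> z"
    and lhd_ne: "\<lbrakk>x \<in> V; y \<in> V; z \<in> V\<rbrakk> \<Longrightarrow> sum_product sw nw x y \<nearrow> z = sum_product ne se x y \<nearrow> z"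

definition left_mult :: "('v \<Rightarrow> 'v \<Rightarrow> 'v) \<Rightarrow> 'v \<Rightarrow> 'v \<Rightarrow> 'v" where
  "left_mult f x y = f x y"

definition right_mult :: "('v \<Rightarrow> 'v \<Rightarrow> 'v) \<Rightarrow> 'v \<Rightarrow> 'v \<Rightarrow> 'v" where
  "right_mult f y x = f x y"

definition dual_space :: "('k::field \<Rightarrow> 'v::ab_group_add \<Rightarrow> 'v) \<Rightarrow> ('v \<Rightarrow> 'k) set" where
  "dual_space scale = {f. Vector_Spaces.linear scale (*) f}"

definition dual_map :: "('v \<Rightarrow> 'v \<Rightarrow> 'v) \<Rightarrow> 'v \<Rightarrow> ('v \<Rightarrow> 'k::uminus) \<Rightarrow> 'v \<Rightarrow> 'k" where
  "dual_map \<phi> x f u = - f (\<phi> x u)"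

text \<open>
  The dialgebra on \<open>A \<oplus> A\<^sup>*\<close>, where \<open>A\<close> is the whole type \<open>'v\<close>. Signed sums of maps such as
  \<open>- dual_map (left_mult ne) + dual_map (left_mult sw)\<close> are pointwise, by \<open>Function_Algebras\<close>.
\<close>

definition hat_space :: "('k::field \<Rightarrow> 'v::ab_group_add \<Rightarrow> 'v) \<Rightarrow> ('v \<times> ('v \<Rightarrow> 'k)) set" where
  "hat_space scale = UNIV \<times> dual_space scale"

fun hat_scale ::
  "('k::field \<Rightarrow> 'v::ab_group_add \<Rightarrow> 'v) \<Rightarrow> 'k \<Rightarrow> 'v \<times> ('v \<Rightarrow> 'k) \<Rightarrow> 'v \<times> ('v \<Rightarrow> 'k)" where
  "hat_scale scale c (x, a) = (scale c x, \<lambda>u. c * a u)"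

fun hat_rhd :: "('v \<Rightarrow> 'v \<Rightarrow> 'v::ab_group_add) \<Rightarrow> ('v \<Rightarrow> 'v \<Rightarrow> 'v) \<Rightarrow> ('v \<Rightarrow> 'v \<Rightarrow> 'v) \<Rightarrow> ('v \<Rightarrow> 'v \<Rightarrow> 'v) \<Rightarrow>
    'v \<times> ('v \<Rightarrow> 'k::field) \<Rightarrow> 'v \<times> ('v \<Rightarrow> 'k) \<Rightarrow> 'v \<times> ('v \<Rightarrow> 'k)" where
  "hat_rhd ne se sw nw (x, a) (y, b) =
     (sum_product ne se x y,
      - dual_map (right_mult nw) x b + (- dual_map (left_mult ne) + dual_map (left_mult sw)) y a)"

fun hat_lhd :: "('v \<Rightarrow> 'v \<Rightarrow> 'v::ab_group_add) \<Rightarrow> ('v \<Rightarrow> 'v \<Rightarrow> 'v) \<Rightarrow> ('v \<Rightarrow> 'v \<Rightarrow> 'v) \<Rightarrow> ('v \<Rightarrow> 'v \<Rightarrow> 'v) \<Rightarrow>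
    'v \<times> ('v \<Rightarrow> 'k::field) \<Rightarrow> 'v \<times> ('v \<Rightarrow> 'k) \<Rightarrow> 'v \<times> ('v \<Rightarrow> 'k)" where
  "hat_lhd ne se sw nw (x, a) (y, b) =
     (sum_product sw nw x y,
      (dual_map (right_mult se) - dual_map (right_mult nw)) x b - dual_map (left_mult ne) y a)"

text \<open>
  The tensor power \<open>V\<^bsup>\<otimes>n\<^esup>\<close> is the free vector space on the lists in \<open>V\<close> of length \<open>n\<close>, modulo the
  subspace spanned by the multilinearity relations; \<open>[x, y]\<close> stands for \<open>x \<otimes> y\<close>. Its elements are
  cosets of formal linear combinations.
\<close>

definition pure :: "'v list \<Rightarrow> 'v list \<Rightarrow>\<^sub>0 'k::field" where
  "pure xs = Poly_Mapping.single xs 1"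

definition formal_scale :: "'k::field \<Rightarrow> ('v list \<Rightarrow>\<^sub>0 'k) \<Rightarrow> ('v list \<Rightarrow>\<^sub>0 'k)" where
  "formal_scale c t = Poly_Mapping.map ((*) c) t"

definition formal_tensors :: "'v set \<Rightarrow> nat \<Rightarrow> ('v list \<Rightarrow>\<^sub>0 'k::field) set" where
  "formal_tensors V n = {t. Poly_Mapping.keys t \<subseteq> {xs. length xs = n \<and> set xs \<subseteq> V}}"

definition tensor_relations ::
  "('k::field \<Rightarrow> 'v::ab_group_add \<Rightarrow> 'v) \<Rightarrow> 'v set \<Rightarrow> nat \<Rightarrow> ('v list \<Rightarrow>\<^sub>0 'k) set" where
  "tensor_relations scale V n = module.span formal_scale
     ({pure (xs[i := x + y]) - pure (xs[i := x]) - pure (xs[i := y]) | xs i x y.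
         length xs = n \<and> set xs \<subseteq> V \<and> i < n \<and> x \<in> V \<and> y \<in> V} \<union>
      {pure (xs[i := scale c x]) - formal_scale c (pure (xs[i := x])) | xs i c x.
         length xs = n \<and> set xs \<subseteq> V \<and> i < n \<and> x \<in> V})"

definition tensor_cong ::
  "('k::field \<Rightarrow> 'v::ab_group_add \<Rightarrow> 'v) \<Rightarrow> 'v set \<Rightarrow> nat \<Rightarrow> (('v list \<Rightarrow>\<^sub>0 'k) \<times> ('v list \<Rightarrow>\<^sub>0 'k)) set" where
  "tensor_cong scale V n =
     {(s, t). s \<in> formal_tensors V n \<and> t \<in> formal_tensors V n \<and> s - t \<in> tensor_relations scale V n}"

definition tensor_power ::
  "('k::field \<Rightarrow> 'v::ab_group_add \<Rightarrow> 'v) \<Rightarrow> 'v set \<Rightarrow> nat \<Rightarrow> ('v list \<Rightarrow>\<^sub>0 'k) set set" where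
  "tensor_power scale V n = formal_tensors V n // tensor_cong scale V n"

definition tensor_class ::
  "('k::field \<Rightarrow> 'v::ab_group_add \<Rightarrow> 'v) \<Rightarrow> 'v set \<Rightarrow> nat \<Rightarrow> ('v list \<Rightarrow>\<^sub>0 'k) \<Rightarrow> ('v list \<Rightarrow>\<^sub>0 'k) set" where
  "tensor_class scale V n t = tensor_cong scale V n `` {t}"

text \<open>
  The flip \<open>\<tau>\<close> acts on a coset in \<open>V \<otimes> V\<close> elementwise: on formal combinations, \<open>map_key rev\<close> is the
  linear map with \<open>[x, y] \<mapsto> [y, x]\<close>, and it preserves the multilinearity relations.
\<close>

definition flip :: "('v list \<Rightarrow>\<^sub>0 'k::field) set \<Rightarrow> ('v list \<Rightarrow>\<^sub>0 'k) set" where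
  "flip r = Poly_Mapping.map_key rev ` r"

definition symmetric_tensor :: "('v list \<Rightarrow>\<^sub>0 'k::field) set \<Rightarrow> bool" where
  "symmetric_tensor r \<longleftrightarrow> flip r = r"

text \<open>
  The equation is required for every expression \<open>r = \<Sum>\<^sub>i a\<^sub>i \<otimes> b\<^sub>i\<close>, so that the predicate depends on
  the tensor \<open>r\<close> only. Every element of \<open>V \<otimes> V\<close> has such an expression.
\<close>

definition daybe_solution ::
  "('k::field \<Rightarrow> 'v::ab_group_add \<Rightarrow> 'v) \<Rightarrow> 'v set \<Rightarrow> ('v \<Rightarrow> 'v \<Rightarrow> 'v) \<Rightarrow> ('v \<Rightarrow> 'v \<Rightarrow> 'v) \<Rightarrow>
     ('v list \<Rightarrow>\<^sub>0 'k) set \<Rightarrow> bool" where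
  "daybe_solution scale V rhd lhd r \<longleftrightarrow>
     r \<in> tensor_power scale V 2 \<and>
     (\<forall>m a b. (\<forall>i<m. a i \<in> V \<and> b i \<in> V) \<and> r = tensor_class scale V 2 (\<Sum>i<m. pure [a i, b i]) \<longrightarrow>
        tensor_class scale V 3
          (\<Sum>i<m. \<Sum>j<(m::nat). pure [a i, a j, rhd (b i) (b j)]
             - pure [a j, lhd (a i) (b j), b i]
             - pure [rhd (a i) (a j) - lhd (a i) (a j), b i, b j])
        = tensor_class scale V 3 0)"

end

theory Submission
  imports Defs
begin

text \<open>
  The double \<open>A \<oplus> A\<^sup>*\<close> carries the symmetric nondegenerate form
  \<open>\<omega>(x + a, y + b) = a(y) + b(x)\<close>, and \<open>r = \<Sum>\<^sub>k b\<^sub>k \<otimes> b'\<^sub>k\<close> is its Casimir element, for a basis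
  \<open>b\<^sub>k\<close> with \<open>\<omega>\<close>-dual basis \<open>b'\<^sub>k\<close>. Hence contracting one leg of \<open>r\<close> with \<open>\<omega>(u, -)\<close> leaves \<open>u\<close> on the
  other leg. Applying \<open>\<omega>(u, -) \<otimes> \<omega>(v, -) \<otimes> \<omega>(w, -)\<close> to the left-hand side of the DAYBE therefore gives
  \<open>\<omega>(w, u \<rhd> v) - \<omega>(v, w \<lhd> u) - \<omega>(u, v \<star> w)\<close>, which vanishes by the definition of the products
  on the double. Such functionals separate the points of the triple tensor power.
\<close>

section \<open>Formal tensors\<close>

lemma lookup_formal_scale [simp]:
  "Poly_Mapping.lookup (formal_scale c t) xs = c * Poly_Mapping.lookup t xs"
  unfolding formal_scale_def by transfer (auto simp: when_def)

interpretation formal: vector_space "formal_scale :: 'k::field \<Rightarrow> ('v list \<Rightarrow>\<^sub>0 'k) \<Rightarrow> _"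
  by unfold_locales (auto intro!: poly_mapping_eqI simp: lookup_add algebra_simps)

lemma subspace_tensor_relations: "formal.subspace (tensor_relations scale V n)"
  unfolding tensor_relations_def by (rule formal.subspace_span)

lemmas zero_tensor_relations = formal.subspace_0[OF subspace_tensor_relations]
  and add_tensor_relations = formal.subspace_add[OF subspace_tensor_relations]
  and neg_tensor_relations = formal.subspace_neg[OF subspace_tensor_relations]
  and scale_tensor_relations = formal.subspace_scale[OF subspace_tensor_relations]
  and sum_tensor_relations = formal.subspace_sum[OF subspace_tensor_relations]

lemma tensor_relations_add:
  "\<lbrakk>length xs = n; set xs \<subseteq> V; i < n; x \<in> V; y \<in> V\<rbrakk> \<Longrightarrow>
    pure (xs[i := x + y]) - pure (xs[i := x]) - pure (xs[i := y]) \<in> tensor_relations scale V n"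
  unfolding tensor_relations_def by (rule formal.span_base) blast

lemma tensor_relations_scale:
  "\<lbrakk>length xs = n; set xs \<subseteq> V; i < n; x \<in> V\<rbrakk> \<Longrightarrow>
    pure (xs[i := scale c x]) - formal_scale c (pure (xs[i := x])) \<in> tensor_relations scale V n"
  unfolding tensor_relations_def by (rule formal.span_base) blast

lemma formal_tensors_add:
  "\<lbrakk>s \<in> formal_tensors V n; t \<in> formal_tensors V n\<rbrakk> \<Longrightarrow> s + t \<in> formal_tensors V n"
  using keys_add[of s t] unfolding formal_tensors_def by blast

lemma formal_tensors_diff:
  "\<lbrakk>s \<in> formal_tensors V n; t \<in> formal_tensors V n\<rbrakk> \<Longrightarrow> s - t \<in> formal_tensors V n"
  using keys_diff[of s t] unfolding formal_tensors_def by blast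

lemma formal_tensors_zero: "0 \<in> formal_tensors V n"
  by (simp add: formal_tensors_def)

lemma formal_tensors_sum:
  "(\<And>i. i \<in> I \<Longrightarrow> f i \<in> formal_tensors V n) \<Longrightarrow> sum f I \<in> formal_tensors V n"
  by (induction I rule: infinite_finite_induct) (auto intro: formal_tensors_add formal_tensors_zero)

lemma formal_tensors_pure:
  "\<lbrakk>length xs = n; set xs \<subseteq> V\<rbrakk> \<Longrightarrow> pure xs \<in> formal_tensors V n"
  by (simp add: formal_tensors_def pure_def)

lemma equiv_tensor_cong: "equiv (formal_tensors V n) (tensor_cong scale V n)"
proof (rule equivI)
  show "refl_on (formal_tensors V n) (tensor_cong scale V n)"
    by (auto simp: refl_on_def tensor_cong_def zero_tensor_relations)
  show "sym (tensor_cong scale V n)"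
  proof (rule symI)
    fix s t assume "(s, t) \<in> tensor_cong scale V n"
    then show "(t, s) \<in> tensor_cong scale V n"
      using neg_tensor_relations[of "s - t" scale V n] by (simp add: tensor_cong_def)
  qed
  show "trans (tensor_cong scale V n)"
  proof (rule transI)
    fix s t u assume "(s, t) \<in> tensor_cong scale V n" "(t, u) \<in> tensor_cong scale V n"
    then show "(s, u) \<in> tensor_cong scale V n"
      using add_tensor_relations[of "s - t" scale V n "t - u"] by (simp add: tensor_cong_def)
  qed
  show "tensor_cong scale V n \<subseteq> formal_tensors V n \<times> formal_tensors V n"
    by (auto simp: tensor_cong_def)
qed

lemma tensor_class_eq_iff:
  "\<lbrakk>s \<in> formal_tensors V n; t \<in> formal_tensors V n\<rbrakk> \<Longrightarrow>
    tensor_class scale V n s = tensor_class scale V n t \<longleftrightarrow> s - t \<in> tensor_relations scale V n"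
  unfolding tensor_class_def
  by (subst eq_equiv_class_iff[OF equiv_tensor_cong]) (auto simp: tensor_cong_def)

lemma tensor_class_in_tensor_power:
  "t \<in> formal_tensors V n \<Longrightarrow> tensor_class scale V n t \<in> tensor_power scale V n"
  unfolding tensor_class_def tensor_power_def by (rule quotientI)

section \<open>Evaluation of formal tensors\<close>

text \<open>The linear extension to formal combinations of an arbitrary function \<open>F\<close> on
  lists; it descends to the tensor power once \<open>F\<close> is multilinear.\<close>

definition tensor_eval :: "('v list \<Rightarrow> 'k) \<Rightarrow> ('v list \<Rightarrow>\<^sub>0 'k::field) \<Rightarrow> 'k" where
  "tensor_eval F t = (\<Sum>xs\<in>Poly_Mapping.keys t. Poly_Mapping.lookup t xs * F xs)"

text \<open>Formal tensors and their sum may have different keys; a common finite index set makes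
  their evaluations comparable.\<close>

lemma tensor_eval_superset:
  "\<lbrakk>finite S; Poly_Mapping.keys t \<subseteq> S\<rbrakk> \<Longrightarrow>
    tensor_eval F t = (\<Sum>xs\<in>S. Poly_Mapping.lookup t xs * F xs)"
  unfolding tensor_eval_def by (rule sum.mono_neutral_left) (auto simp: in_keys_iff)

lemma tensor_eval_pure [simp]: "tensor_eval F (pure xs) = F xs"
  by (simp add: tensor_eval_def pure_def)

lemma tensor_eval_zero [simp]: "tensor_eval F 0 = 0"
  by (simp add: tensor_eval_def)

lemma tensor_eval_add: "tensor_eval F (s + t) = tensor_eval F s + tensor_eval F t"
proof -
  let ?S = "Poly_Mapping.keys s \<union> Poly_Mapping.keys t"
  have "tensor_eval F (s + t) = (\<Sum>xs\<in>?S. Poly_Mapping.lookup (s + t) xs * F xs)"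
    by (rule tensor_eval_superset) (auto simp: keys_add)
  also have "\<dots> = tensor_eval F s + tensor_eval F t"
    by (simp add: tensor_eval_superset[of ?S] lookup_add algebra_simps sum.distrib)
  finally show ?thesis .
qed

lemma tensor_eval_scale: "tensor_eval F (formal_scale c t) = c * tensor_eval F t"
proof -
  have "tensor_eval F (formal_scale c t) =
      (\<Sum>xs\<in>Poly_Mapping.keys t. Poly_Mapping.lookup (formal_scale c t) xs * F xs)"
    by (rule tensor_eval_superset) (auto simp: in_keys_iff)
  then show ?thesis
    by (simp add: tensor_eval_def sum_distrib_left mult.assoc)
qed

lemma tensor_eval_diff: "tensor_eval F (s - t) = tensor_eval F s - tensor_eval F t"
  using tensor_eval_add[of F "s - t" t] by simp

lemma tensor_eval_sum: "tensor_eval F (sum f I) = (\<Sum>i\<in>I. tensor_eval F (f i))"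
  by (induction I rule: infinite_finite_induct) (auto simp: tensor_eval_add)

text \<open>The kernel of the evaluation is a subspace, and multilinearity of \<open>F\<close> puts
  both families of generators into it.\<close>

lemma tensor_eval_relations:
  assumes t: "t \<in> tensor_relations scale V n"
    and add: "\<And>xs i x y. \<lbrakk>length xs = n; set xs \<subseteq> V; i < n; x \<in> V; y \<in> V\<rbrakk> \<Longrightarrow>
      F (xs[i := x + y]) = F (xs[i := x]) + F (xs[i := y])"
    and scale: "\<And>xs i c x. \<lbrakk>length xs = n; set xs \<subseteq> V; i < n; x \<in> V\<rbrakk> \<Longrightarrow>
      F (xs[i := scale c x]) = c * F (xs[i := x])"
  shows "tensor_eval F t = 0"
  using t unfolding tensor_relations_def
proof (induction t rule: formal.span_induct)
  case base
  show ?case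
    by (rule formal.subspaceI) (auto simp: tensor_eval_add tensor_eval_scale)
next
  case (step t)
  then show ?case
    by (auto simp: tensor_eval_diff tensor_eval_scale add scale)
qed

text \<open>Linearity is asked on the carrier only, because the products of a
  \<open>dialgebra\<close> are known to be bilinear only there.\<close>

definition linear_form_on ::
  "('k::field \<Rightarrow> 'v::ab_group_add \<Rightarrow> 'v) \<Rightarrow> 'v set \<Rightarrow> ('v \<Rightarrow> 'k) \<Rightarrow> bool" where
  "linear_form_on scale V f \<longleftrightarrow>
     (\<forall>x\<in>V. \<forall>y\<in>V. f (x + y) = f x + f y) \<and> (\<forall>c. \<forall>x\<in>V. f (scale c x) = c * f x)"

text \<open>It serves to show that a bilinear functional takes the same value on any two expressions
  of one tensor.\<close>

lemma tensor_eval_bilinear_relations: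
  assumes "t \<in> tensor_relations scale V 2"
    and l: "\<And>y. y \<in> V \<Longrightarrow> linear_form_on scale V (\<lambda>x. \<beta> x y)"
    and r: "\<And>x. x \<in> V \<Longrightarrow> linear_form_on scale V (\<beta> x)"
  shows "tensor_eval (\<lambda>xs. \<beta> (xs ! 0) (xs ! 1)) t = 0"
proof (rule tensor_eval_relations[OF assms(1)])
  fix xs x y and i :: nat assume xs: "length xs = 2" "set xs \<subseteq> V" "i < 2" "x \<in> V" "y \<in> V"
  then have "xs ! 0 \<in> V" "xs ! 1 \<in> V" by (auto intro!: nth_mem)
  with xs l r show "\<beta> (xs[i := x + y] ! 0) (xs[i := x + y] ! 1) =
      \<beta> (xs[i := x] ! 0) (xs[i := x] ! 1) + \<beta> (xs[i := y] ! 0) (xs[i := y] ! 1)"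
    by (cases "i = 0") (auto simp: linear_form_on_def less_2_cases_iff)
next
  fix xs c x and i :: nat assume xs: "length xs = 2" "set xs \<subseteq> V" "i < 2" "x \<in> V"
  then have "xs ! 0 \<in> V" "xs ! 1 \<in> V" by (auto intro!: nth_mem)
  with xs l r show "\<beta> (xs[i := scale c x] ! 0) (xs[i := scale c x] ! 1) =
      c * \<beta> (xs[i := x] ! 0) (xs[i := x] ! 1)"
    by (cases "i = 0") (auto simp: linear_form_on_def less_2_cases_iff)
qed

section \<open>Coordinates on tensor powers\<close>

context vector_space
begin

lemma linear_form_on_sum:
  assumes "subspace V" "linear_form_on scale V f" "\<And>k. k \<in> K \<Longrightarrow> g k \<in> V"
  shows "f (\<Sum>k\<in>K. scale (c k) (g k)) = (\<Sum>k\<in>K. c k * f (g k))"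
proof -
  have "f 0 = 0"
    using assms(1,2) subspace_0 unfolding linear_form_on_def by (metis add_cancel_right_right add_0)
  with assms(3) show ?thesis
  proof (induction K rule: infinite_finite_induct)
    case (insert k K)
    then have "scale (c k) (g k) \<in> V" "(\<Sum>k\<in>K. scale (c k) (g k)) \<in> V"
      using assms(1) by (auto intro: subspace_scale subspace_sum)
    with insert assms(2) show ?case by (simp add: linear_form_on_def)
  qed auto
qed

text \<open>Induction on \<open>K\<close>: the additivity relation splits off one summand, the
  scaling relation extracts its coefficient, and the induction hypothesis treats the rest; the three
  differences telescope.\<close>

lemma pure_update_sum:
  assumes V: "subspace V" and xs: "length xs = n" "set xs \<subseteq> V" "i < n"
    and g: "\<And>k. k \<in> K \<Longrightarrow> g k \<in> V"
  shows "pure (xs[i := \<Sum>k\<in>K. scale (c k) (g k)]) -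
      (\<Sum>k\<in>K. formal_scale (c k) (pure (xs[i := g k]))) \<in> tensor_relations scale V n"
proof -
  \<comment> \<open>The scaling relation with scalar 0 kills a tensor with a zero slot. This settles
    the empty sum, and also an infinite \<open>K\<close>, where the sum is 0 by convention.\<close>
  have zero: "pure (xs[i := 0]) \<in> tensor_relations scale V n"
    using tensor_relations_scale[OF xs subspace_0[OF V], of scale 0] by simp
  from g show ?thesis
  proof (induction K rule: infinite_finite_induct)
    case (insert k K)
    let ?x = "scale (c k) (g k)" and ?y = "\<Sum>k\<in>K. scale (c k) (g k)"
    have "?x \<in> V" "?y \<in> V"
      using V insert.prems by (auto intro: subspace_scale subspace_sum)
    then have add: "pure (xs[i := ?x + ?y]) - pure (xs[i := ?x]) - pure (xs[i := ?y])
        \<in> tensor_relations scale V n"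
      by (rule tensor_relations_add[OF xs])
    have head: "pure (xs[i := ?x]) - formal_scale (c k) (pure (xs[i := g k]))
        \<in> tensor_relations scale V n"
      using insert.prems by (intro tensor_relations_scale[OF xs]) auto
    have tail: "pure (xs[i := ?y]) - (\<Sum>k\<in>K. formal_scale (c k) (pure (xs[i := g k])))
        \<in> tensor_relations scale V n"
      using insert by auto
    show ?case
      using insert.hyps add_tensor_relations[OF add_tensor_relations[OF add head] tail]
      by (simp add: algebra_simps)
  qed (use zero in auto)
qed

end

section \<open>Threefold tensors in coordinates\<close>

context vector_space
begin

text \<open>The slots are expanded from left to right. Each stage is \<open>pure_update_sum\<close>
  for one slot, weighted by the coefficients already extracted, and the stages telescope.\<close>

lemma pure3_expand:
  assumes V: "subspace V" and b: "\<And>k. k \<in> K \<Longrightarrow> b k \<in> V"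
    and c: "\<And>v. v \<in> V \<Longrightarrow> v = (\<Sum>k\<in>K. scale (c k v) (b k))"
    and xyz: "x \<in> V" "y \<in> V" "z \<in> V"
  shows "pure [x, y, z] -
      (\<Sum>i\<in>K. \<Sum>j\<in>K. \<Sum>k\<in>K. formal_scale (c i x * c j y * c k z) (pure [b i, b j, b k]))
    \<in> tensor_relations scale V 3"
proof -
  have 1: "pure [x, y, z] - (\<Sum>i\<in>K. formal_scale (c i x) (pure [b i, y, z]))
      \<in> tensor_relations scale V 3"
    using pure_update_sum[of V "[x, y, z]" 3 0 K b "\<lambda>k. c k x"] V b xyz c[of x] by simp
  have "pure [b i, y, z] - (\<Sum>j\<in>K. formal_scale (c j y) (pure [b i, b j, z]))
      \<in> tensor_relations scale V 3" if "i \<in> K" for i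
    using pure_update_sum[of V "[b i, y, z]" 3 1 K b "\<lambda>k. c k y"] V b xyz c[of y] that by simp
  then have 2: "(\<Sum>i\<in>K. formal_scale (c i x)
      (pure [b i, y, z] - (\<Sum>j\<in>K. formal_scale (c j y) (pure [b i, b j, z]))))
      \<in> tensor_relations scale V 3"
    by (intro sum_tensor_relations scale_tensor_relations)
  have "pure [b i, b j, z] - (\<Sum>k\<in>K. formal_scale (c k z) (pure [b i, b j, b k]))
      \<in> tensor_relations scale V 3" if "i \<in> K" "j \<in> K" for i j
    using pure_update_sum[of V "[b i, b j, z]" 3 2 K b "\<lambda>k. c k z"] V b xyz c[of z] that
    by (simp add: numeral_2_eq_2)
  then have 3: "(\<Sum>i\<in>K. formal_scale (c i x) (\<Sum>j\<in>K. formal_scale (c j y)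
      (pure [b i, b j, z] - (\<Sum>k\<in>K. formal_scale (c k z) (pure [b i, b j, b k])))))
      \<in> tensor_relations scale V 3"
    by (intro sum_tensor_relations scale_tensor_relations)
  from add_tensor_relations[OF 1 add_tensor_relations[OF 2 3]] show ?thesis
    by (simp add: formal.scale_right_diff_distrib formal.scale_sum_right sum_subtractf mult.assoc)
qed

text \<open>Coordinate functionals separate points: expanding every list in the support of
  \<open>t\<close> makes \<open>t\<close> congruent to a combination of the
  \<open>[b i, b j, b k]\<close> whose coefficients are evaluations of \<open>t\<close>, and these
  vanish by \<open>eval\<close>.\<close>

lemma tensor_relations_3I:
  assumes V: "subspace V" and b: "\<And>k. k \<in> K \<Longrightarrow> b k \<in> V"
    and c: "\<And>v. v \<in> V \<Longrightarrow> v = (\<Sum>k\<in>K. scale (c k v) (b k))"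
    and t: "t \<in> formal_tensors V 3"
    and eval: "\<And>i j k. \<lbrakk>i \<in> K; j \<in> K; k \<in> K\<rbrakk> \<Longrightarrow>
      tensor_eval (\<lambda>xs. c i (xs ! 0) * c j (xs ! 1) * c k (xs ! 2)) t = 0"
  shows "t \<in> tensor_relations scale V 3"
proof -
  let ?keys = "Poly_Mapping.keys t" and ?F = "\<lambda>i j k xs. c i (xs ! 0) * c j (xs ! 1) * c k (xs ! 2)"
  let ?E = "\<lambda>xs. \<Sum>i\<in>K. \<Sum>j\<in>K. \<Sum>k\<in>K. formal_scale (?F i j k xs) (pure [b i, b j, b k])"
  have "pure xs - ?E xs \<in> tensor_relations scale V 3" if "xs \<in> ?keys" for xs
  proof -
    have "length xs = 3" "set xs \<subseteq> V" using t that by (auto simp: formal_tensors_def)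
    then obtain x y z where "xs = [x, y, z]" "x \<in> V" "y \<in> V" "z \<in> V"
      by (auto simp: numeral_3_eq_3 length_Suc_conv)
    then show ?thesis using pure3_expand[OF V b c, of x y z] by simp
  qed
  then have "(\<Sum>xs\<in>?keys. formal_scale (Poly_Mapping.lookup t xs) (pure xs - ?E xs))
      \<in> tensor_relations scale V 3"
    by (intro sum_tensor_relations scale_tensor_relations)
  moreover have "(\<Sum>xs\<in>?keys. formal_scale (Poly_Mapping.lookup t xs) (pure xs)) = t"
    by (rule poly_mapping_eqI)
      (auto simp: lookup_sum pure_def lookup_single when_def sum.delta not_in_keys_iff_lookup_eq_zero
        if_distrib[of "(*) _"] cong: if_cong)
  \<comment> \<open>Interchanging the sum over keys with the sums over \<open>K\<close> gathers an
    evaluation of \<open>t\<close> in front of each \<open>[b i, b j, b k]\<close>.\<close>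
  moreover have "(\<Sum>xs\<in>?keys. formal_scale (Poly_Mapping.lookup t xs) (?E xs)) =
      (\<Sum>i\<in>K. \<Sum>j\<in>K. \<Sum>k\<in>K. formal_scale (tensor_eval (?F i j k) t) (pure [b i, b j, b k]))"
    unfolding tensor_eval_def formal.scale_sum_right formal.scale_sum_left
    by (subst sum.swap, rule sum.cong[OF refl])+ simp
  moreover have "\<dots> = 0" using eval by simp
  ultimately show ?thesis by (simp add: formal.scale_right_diff_distrib sum_subtractf)
qed

end

section \<open>The Casimir element of an invariant form\<close>

text \<open>The two expansions say that \<open>b\<close> and \<open>b'\<close> are dual with respect
  to \<omega>; \<open>invariant\<close> is the scalar identity that remains when all three legs of
  the equation are contracted.\<close>

lemma (in dialgebra) daybe_solution_casimir:
  assumes b: "\<And>k. k \<in> K \<Longrightarrow> b k \<in> V" and b': "\<And>k. k \<in> K \<Longrightarrow> b' k \<in> V"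
    and form: "\<And>u. u \<in> V \<Longrightarrow> linear_form_on scale V (\<omega> u)"
    and sym: "\<And>u v. \<lbrakk>u \<in> V; v \<in> V\<rbrakk> \<Longrightarrow> \<omega> u v = \<omega> v u"
    and expand: "\<And>v. v \<in> V \<Longrightarrow> v = (\<Sum>k\<in>K. scale (\<omega> v (b' k)) (b k))"
    and expand': "\<And>v. v \<in> V \<Longrightarrow> v = (\<Sum>k\<in>K. scale (\<omega> v (b k)) (b' k))"
    and invariant: "\<And>u v w. \<lbrakk>u \<in> V; v \<in> V; w \<in> V\<rbrakk> \<Longrightarrow>
      \<omega> w (u \<rhd> v) = \<omega> v (w \<lhd> u) + \<omega> u (v \<rhd> w - v \<lhd> w)"
  shows "daybe_solution scale V (\<rhd>) (\<lhd>) (tensor_class scale V 2 (\<Sum>k\<in>K. pure [b k, b' k]))"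
proof -
  note V = subspace_carrier
  have rhdV: "x \<rhd> y \<in> V" and lhdV: "x \<lhd> y \<in> V" if "x \<in> V" "y \<in> V" for x y
    using bilinear_rhd bilinear_lhd that by (auto simp: bilinear_product_def)
  have form_diff: "\<omega> u (x - y) = \<omega> u x - \<omega> u y" if "u \<in> V" "x \<in> V" "y \<in> V" for u x y
  proof -
    have "\<omega> u ((x - y) + y) = \<omega> u (x - y) + \<omega> u y"
      using form[OF that(1)] subspace_diff[OF V that(2,3)] that(3)
      unfolding linear_form_on_def by blast
    then show ?thesis by simp
  qed
  let ?t = "\<Sum>k\<in>K. pure [b k, b' k]"
  have t: "?t \<in> formal_tensors V 2"
    using b b' by (intro formal_tensors_sum formal_tensors_pure) auto
  {
    \<comment> \<open>\<open>daybe_solution\<close> quantifies over all expressions of the tensor,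
      so an arbitrary one is taken.\<close>
    fix m :: nat and a d :: "nat \<Rightarrow> 'v"
    assume aV: "\<And>i. i < m \<Longrightarrow> a i \<in> V" and dV: "\<And>i. i < m \<Longrightarrow> d i \<in> V"
      and eq: "tensor_class scale V 2 ?t = tensor_class scale V 2 (\<Sum>i<m. pure [a i, d i])"
    have rel: "(\<Sum>i<m. pure [a i, d i]) - ?t \<in> tensor_relations scale V 2"
      using eq aV dV t
      by (subst tensor_class_eq_iff[symmetric]) (auto intro!: formal_tensors_sum formal_tensors_pure)
    \<comment> \<open>The two expressions differ by a relation, so a bilinear \<open>\<beta>\<close>
      may be summed over the dual families instead.\<close>
    have transfer: "(\<Sum>i<m. \<beta> (a i) (d i)) = (\<Sum>k\<in>K. \<beta> (b k) (b' k))"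
      if "\<And>y. y \<in> V \<Longrightarrow> linear_form_on scale V (\<lambda>x. \<beta> x y)"
        "\<And>x. x \<in> V \<Longrightarrow> linear_form_on scale V (\<beta> x)" for \<beta>
      using tensor_eval_bilinear_relations[OF rel that] by (simp add: tensor_eval_diff tensor_eval_sum)
    \<comment> \<open>Contracting the first leg with \<open>\<omega> u\<close> turns the second leg
      into \<open>u\<close>, by \<open>expand'\<close>; \<open>right\<close> treats the other leg by
      \<open>expand\<close>.\<close>
    have left: "(\<Sum>i<m. \<omega> u (a i) * f (d i)) = f u"
      if u: "u \<in> V" and f: "linear_form_on scale V f" for u f
    proof -
      have "(\<Sum>i<m. \<omega> u (a i) * f (d i)) = (\<Sum>k\<in>K. \<omega> u (b k) * f (b' k))"
        using f form[OF u] by (intro transfer) (auto simp: linear_form_on_def algebra_simps)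
      also have "\<dots> = f u"
        using linear_form_on_sum[OF V f, of K b' "\<lambda>k. \<omega> u (b k)"] b' expand'[OF u, symmetric] by simp
      finally show ?thesis .
    qed
    have right: "(\<Sum>i<m. f (a i) * \<omega> u (d i)) = f u"
      if u: "u \<in> V" and f: "linear_form_on scale V f" for u f
    proof -
      have "(\<Sum>i<m. f (a i) * \<omega> u (d i)) = (\<Sum>k\<in>K. f (b k) * \<omega> u (b' k))"
        using f form[OF u] by (intro transfer) (auto simp: linear_form_on_def algebra_simps)
      also have "\<dots> = f u"
        using linear_form_on_sum[OF V f, of K b "\<lambda>k. \<omega> u (b' k)"] b expand[OF u, symmetric]
        by (simp add: mult.commute)
      finally show ?thesis .
    qed
    have lin: "linear_form_on scale V (\<lambda>y. \<omega> w (x \<rhd> y))" "linear_form_on scale V (\<lambda>y. \<omega> w (y \<rhd> x))"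
      "linear_form_on scale V (\<lambda>y. \<omega> w (x \<lhd> y))" "linear_form_on scale V (\<lambda>y. \<omega> w (y \<lhd> x))"
      if "x \<in> V" "w \<in> V" for x w
      using that form[OF that(2)] bilinear_rhd bilinear_lhd
      by (auto simp: linear_form_on_def bilinear_product_def)
    let ?T = "\<Sum>i<m. \<Sum>j<m. pure [a i, a j, d i \<rhd> d j] - pure [a j, a i \<lhd> d j, d i]
      - pure [a i \<rhd> a j - a i \<lhd> a j, d i, d j]"
    have T: "?T \<in> formal_tensors V 3"
      using aV dV rhdV lhdV subspace_diff[OF V]
      by (intro formal_tensors_sum formal_tensors_diff formal_tensors_pure) auto
    have eval: "tensor_eval (\<lambda>xs. \<omega> u (xs ! 0) * \<omega> v (xs ! 1) * \<omega> w (xs ! 2)) ?T = 0"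
      if uvw: "u \<in> V" "v \<in> V" "w \<in> V" for u v w
    proof -
      \<comment> \<open>Both copies are contracted in their first legs: the sum over
        \<open>j\<close> puts \<open>v\<close> for \<open>d j\<close>, then the sum over
        \<open>i\<close> puts \<open>u\<close> for \<open>d i\<close>.\<close>
      have 1: "(\<Sum>i<m. \<Sum>j<m. \<omega> u (a i) * \<omega> v (a j) * \<omega> w (d i \<rhd> d j)) = \<omega> w (u \<rhd> v)"
      proof -
        have "(\<Sum>i<m. \<Sum>j<m. \<omega> u (a i) * \<omega> v (a j) * \<omega> w (d i \<rhd> d j)) =
            (\<Sum>i<m. \<omega> u (a i) * (\<Sum>j<m. \<omega> v (a j) * \<omega> w (d i \<rhd> d j)))"
          by (simp add: sum_distrib_left mult.assoc)
        also have "\<dots> = (\<Sum>i<m. \<omega> u (a i) * \<omega> w (d i \<rhd> v))"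
          using dV uvw by (intro sum.cong refl) (simp add: left[of v "\<lambda>y. \<omega> w (d i \<rhd> y)" for i] lin)
        also have "\<dots> = \<omega> w (u \<rhd> v)"
          using uvw by (intro left[of u "\<lambda>x. \<omega> w (x \<rhd> v)"] lin)
        finally show ?thesis .
      qed
      \<comment> \<open>Copy \<open>j\<close> is contracted in its first leg and copy
        \<open>i\<close> in its second, so \<open>u\<close> replaces \<open>d j\<close> and
        \<open>w\<close> replaces \<open>a i\<close>.\<close>
      have 2: "(\<Sum>i<m. \<Sum>j<m. \<omega> u (a j) * \<omega> v (a i \<lhd> d j) * \<omega> w (d i)) = \<omega> v (w \<lhd> u)"
      proof -
        have "(\<Sum>i<m. \<Sum>j<m. \<omega> u (a j) * \<omega> v (a i \<lhd> d j) * \<omega> w (d i)) =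
            (\<Sum>i<m. (\<Sum>j<m. \<omega> u (a j) * \<omega> v (a i \<lhd> d j)) * \<omega> w (d i))"
          by (simp add: sum_distrib_right)
        also have "\<dots> = (\<Sum>i<m. \<omega> v (a i \<lhd> u) * \<omega> w (d i))"
          using aV uvw by (intro sum.cong refl) (simp add: left[of u "\<lambda>y. \<omega> v (a i \<lhd> y)" for i] lin)
        also have "\<dots> = \<omega> v (w \<lhd> u)"
          using uvw by (intro right[of w "\<lambda>x. \<omega> v (x \<lhd> u)"] lin)
        finally show ?thesis .
      qed
      \<comment> \<open>Both second legs are contracted, so \<open>w\<close> replaces
        \<open>a j\<close> and \<open>v\<close> replaces \<open>a i\<close>, separately in the two
        products.\<close>
      have 3: "(\<Sum>i<m. \<Sum>j<m. \<omega> u (a i \<rhd> a j - a i \<lhd> a j) * \<omega> v (d i) * \<omega> w (d j)) =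
          \<omega> u (v \<rhd> w - v \<lhd> w)"
      proof -
        have "(\<Sum>i<m. \<Sum>j<m. \<omega> u (a i \<rhd> a j - a i \<lhd> a j) * \<omega> v (d i) * \<omega> w (d j)) =
            (\<Sum>i<m. ((\<Sum>j<m. \<omega> u (a i \<rhd> a j) * \<omega> w (d j)) -
              (\<Sum>j<m. \<omega> u (a i \<lhd> a j) * \<omega> w (d j))) * \<omega> v (d i))"
          using aV uvw
          by (simp add: form_diff rhdV lhdV sum_distrib_left sum_distrib_right sum_subtractf algebra_simps)
        also have "\<dots> = (\<Sum>i<m. (\<omega> u (a i \<rhd> w) - \<omega> u (a i \<lhd> w)) * \<omega> v (d i))"
          using aV uvw
          by (intro sum.cong refl) (simp add: right[of w "\<lambda>y. \<omega> u (a i \<rhd> y)" for i]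
            right[of w "\<lambda>y. \<omega> u (a i \<lhd> y)" for i] lin)
        also have "\<dots> = (\<Sum>i<m. \<omega> u (a i \<rhd> w) * \<omega> v (d i)) - (\<Sum>i<m. \<omega> u (a i \<lhd> w) * \<omega> v (d i))"
          by (simp add: left_diff_distrib sum_subtractf)
        also have "\<dots> = \<omega> u (v \<rhd> w) - \<omega> u (v \<lhd> w)"
          using uvw right[of v "\<lambda>x. \<omega> u (x \<rhd> w)"] right[of v "\<lambda>x. \<omega> u (x \<lhd> w)"] by (simp add: lin)
        also have "\<dots> = \<omega> u (v \<rhd> w - v \<lhd> w)"
          using uvw by (simp add: form_diff rhdV lhdV)
        finally show ?thesis .
      qed
      show ?thesis
        using 1 2 3 invariant[OF uvw] by (simp add: tensor_eval_sum tensor_eval_diff sum_subtractf)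
    qed
    have "?T \<in> tensor_relations scale V 3"
    proof (rule tensor_relations_3I[OF V b _ T])
      \<comment> \<open>Symmetry moves \<open>v\<close> to the second argument, so the coordinates
        are the forms \<open>\<omega> (b' k)\<close> and \<open>eval\<close> applies to members of
        \<open>b'\<close>.\<close>
      show "v = (\<Sum>k\<in>K. scale (\<omega> (b' k) v) (b k))" if "v \<in> V" for v
        by (rule trans[OF expand[OF that]]) (auto intro!: sum.cong simp: sym[of v] b' that)
    qed (use eval b' in auto)
    with T have "tensor_class scale V 3 ?T = tensor_class scale V 3 0"
      by (subst tensor_class_eq_iff) (auto simp: formal_tensors_zero)
  }
  then show ?thesis
    using tensor_class_in_tensor_power[OF t] unfolding daybe_solution_def by blast
qed

section \<open>The flip\<close>

lemma lookup_map_key_rev [simp]: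
  "Poly_Mapping.lookup (Poly_Mapping.map_key rev t) xs = Poly_Mapping.lookup t (rev xs)"
  by (simp add: map_key.rep_eq)

text \<open>\<open>map_key\<close> pulls coefficients back along \<open>rev\<close>; as
  \<open>rev\<close> is an involution, this agrees with pushing lists forward.\<close>

lemma map_key_rev_pure: "Poly_Mapping.map_key rev (pure xs) = pure (rev xs)"
  by (rule poly_mapping_eqI) (auto simp: pure_def lookup_single when_def)

lemma map_key_rev_add:
  "Poly_Mapping.map_key rev (s + t) = Poly_Mapping.map_key rev s + Poly_Mapping.map_key rev t"
  by (rule poly_mapping_eqI) (simp add: lookup_add)

lemma map_key_rev_diff:
  fixes s t :: "'v list \<Rightarrow>\<^sub>0 'k::field"
  shows "Poly_Mapping.map_key rev (s - t) = Poly_Mapping.map_key rev s - Poly_Mapping.map_key rev t"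
  by (rule poly_mapping_eqI) (simp add: lookup_minus)

lemma map_key_rev_sum:
  "Poly_Mapping.map_key rev (sum f I) = (\<Sum>i\<in>I. Poly_Mapping.map_key rev (f i))"
  by (rule poly_mapping_eqI) (simp add: lookup_sum)

lemma map_key_rev_scale:
  "Poly_Mapping.map_key rev (formal_scale c t) = formal_scale c (Poly_Mapping.map_key rev t)"
  by (rule poly_mapping_eqI) simp

lemma map_key_rev_formal_tensors:
  assumes "t \<in> formal_tensors V n"
  shows "Poly_Mapping.map_key rev t \<in> formal_tensors V n"
proof -
  have "length xs = n \<and> set xs \<subseteq> V" if "xs \<in> Poly_Mapping.keys (Poly_Mapping.map_key rev t)" for xs
  proof -
    have "rev xs \<in> Poly_Mapping.keys t" using that by (simp add: in_keys_iff)
    with assms show ?thesis by (fastforce simp: formal_tensors_def)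
  qed
  then show ?thesis by (auto simp: formal_tensors_def)
qed

text \<open>The formal tensors whose reversal is a relation form a subspace, so it is enough to
  check generators.\<close>

lemma map_key_rev_tensor_relations:
  fixes scale :: "'k::field \<Rightarrow> 'v::ab_group_add \<Rightarrow> 'v"
  assumes "t \<in> tensor_relations scale V n"
  shows "Poly_Mapping.map_key rev t \<in> tensor_relations scale V n"
proof -
  let ?S = "{t. Poly_Mapping.map_key rev t \<in> tensor_relations scale V n}"
  have "tensor_relations scale V n \<subseteq> ?S"
  proof (subst (1) tensor_relations_def, rule formal.span_minimal)
    show "formal.subspace ?S"
      by (rule formal.subspaceI) (auto simp: map_key_rev_add map_key_rev_scale
        zero_tensor_relations add_tensor_relations scale_tensor_relations)
    show "{pure (xs[i := x + y]) - pure (xs[i := x]) - pure (xs[i := y]) | xs i x y.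
         length xs = n \<and> set xs \<subseteq> V \<and> i < n \<and> x \<in> V \<and> y \<in> V} \<union>
      {pure (xs[i := scale c x]) - formal_scale c (pure (xs[i := x])) | xs i c x.
         length xs = n \<and> set xs \<subseteq> V \<and> i < n \<and> x \<in> V} \<subseteq> ?S"
      \<comment> \<open>Reversal moves slot \<open>i\<close> to slot
        \<open>length xs - i - 1\<close>, so a generator becomes a generator for the reversed
        list.\<close>
      by (auto simp: map_key_rev_diff map_key_rev_scale map_key_rev_pure rev_update subset_iff
          intro!: tensor_relations_add tensor_relations_scale diff_less)
  qed
  with assms show ?thesis by blast
qed

text \<open>Reversal preserves relations, so with a fixed representative it maps the class into
  itself; being an involution, it is then onto the class.\<close>

lemma symmetric_tensor_classI:
  assumes "Poly_Mapping.map_key rev t = t"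
  shows "symmetric_tensor (tensor_class scale V n t)"
proof -
  have *: "Poly_Mapping.map_key rev s \<in> tensor_class scale V n t"
    if "s \<in> tensor_class scale V n t" for s
    using that assms map_key_rev_formal_tensors[of s V n]
      map_key_rev_tensor_relations[of "t - s" scale V n]
    by (auto simp: tensor_class_def tensor_cong_def map_key_rev_diff)
  have "s \<in> flip (tensor_class scale V n t)" if "s \<in> tensor_class scale V n t" for s
    unfolding flip_def
  proof (rule image_eqI[OF _ *[OF that]])
    show "s = Poly_Mapping.map_key rev (Poly_Mapping.map_key rev s)"
      by (rule poly_mapping_eqI) simp
  qed
  with * show ?thesis
    unfolding symmetric_tensor_def by (auto simp: flip_def)
qed

section \<open>The double of a pre-dialgebra\<close>

lemma (in vector_space) dual_space_iff:
  "f \<in> dual_space scale \<longleftrightarrow>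
    (\<forall>x y. f (x + y) = f x + f y) \<and> (\<forall>c x. f (scale c x) = c * f x)"
proof -
  have "vector_space ((*) :: 'a \<Rightarrow> 'a \<Rightarrow> 'a)"
    by unfold_locales (simp_all add: algebra_simps)
  then show ?thesis
    using vector_space_axioms by (simp add: dual_space_def Vector_Spaces.linear_iff)
qed

lemma (in vector_space) dual_space_linear:
  assumes "f \<in> dual_space scale"
  shows "f (x + y) = f x + f y" "f (scale c x) = c * f x" "f 0 = 0" "f (x - y) = f x - f y"
    "f (\<Sum>i\<in>I. g i) = (\<Sum>i\<in>I. f (g i))"
proof -
  show add: "f (x + y) = f x + f y" and scale: "f (scale c x) = c * f x" for x y c
    using assms by (auto simp: dual_space_iff)
  show zero: "f 0 = 0"
    using scale[of 0 0] by simp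
  show "f (x - y) = f x - f y"
    using add[of "x - y" y] by simp
  show "f (\<Sum>i\<in>I. g i) = (\<Sum>i\<in>I. f (g i))"
    by (induction I rule: infinite_finite_induct) (auto simp: add zero)
qed

lemma hat_scale_eq: "hat_scale scale c v = (scale c (fst v), \<lambda>u. c * snd v u)"
  by (cases v) simp

lemma (in vector_space) vector_space_hat_scale: "vector_space (hat_scale scale)"
  by unfold_locales (auto simp: hat_scale_eq fun_eq_iff algebra_simps prod_eq_iff)

lemma (in vector_space) subspace_hat_space:
  "module.subspace (hat_scale scale) (hat_space scale)"
proof -
  interpret hat: vector_space "hat_scale scale" by (rule vector_space_hat_scale)
  show ?thesis
    by (rule hat.subspaceI)
      (auto simp: hat_space_def dual_space_iff hat_scale_eq algebra_simps zero_prod_def)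
qed

fun hat_form :: "'v \<times> ('v \<Rightarrow> 'k::field) \<Rightarrow> 'v \<times> ('v \<Rightarrow> 'k) \<Rightarrow> 'k" where
  "hat_form (x, a) (y, b) = a y + b x"

lemma hat_form_sym: "hat_form u v = hat_form v u"
  by (cases u; cases v) simp

lemma (in vector_space) linear_form_on_hat_form:
  assumes "u \<in> hat_space scale"
  shows "linear_form_on (hat_scale scale) (hat_space scale) (hat_form u)"
  using assms by (cases u) (auto simp: linear_form_on_def hat_space_def dual_space_iff algebra_simps)

lemmas hat_simps = sum_product_def left_mult_def right_mult_def dual_map_def

text \<open>The carrier is the whole type, as in \<open>hat_space\<close>; the membership premises
  of the axioms become trivial, so the axioms yield unconditional rewrite rules.\<close>

locale full_pre_dialgebra = pre_dialgebra scale UNIV ne se sw nw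
  for scale :: "'k::field_char_0 \<Rightarrow> 'v::ab_group_add \<Rightarrow> 'v" and ne se sw nw
begin

section \<open>Identities for the four products and for the double\<close>

lemmas bilinear = upper.bilinear_vd upper.bilinear_dv lower.bilinear_vd lower.bilinear_dv

lemma product_add:
  "ne (x + y) z = ne x z + ne y z" "ne x (y + z) = ne x y + ne x z"
  "se (x + y) z = se x z + se y z" "se x (y + z) = se x y + se x z"
  "sw (x + y) z = sw x z + sw y z" "sw x (y + z) = sw x y + sw x z"
  "nw (x + y) z = nw x z + nw y z" "nw x (y + z) = nw x y + nw x z"
  using bilinear by (auto simp: bilinear_product_def)

lemma product_scale:
  "ne (scale c x) y = scale c (ne x y)" "ne x (scale c y) = scale c (ne x y)"
  "se (scale c x) y = scale c (se x y)" "se x (scale c y) = scale c (se x y)"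
  "sw (scale c x) y = scale c (sw x y)" "sw x (scale c y) = scale c (sw x y)"
  "nw (scale c x) y = scale c (nw x y)" "nw x (scale c y) = scale c (nw x y)"
  using bilinear by (auto simp: bilinear_product_def)

lemma bilinear_hat_rhd:
  "bilinear_product (hat_scale scale) (hat_space scale) (hat_rhd ne se sw nw)"
  unfolding bilinear_product_def hat_space_def
  by (auto simp: hat_simps upper.dual_space_iff product_add product_scale
      fun_eq_iff algebra_simps upper.scale_right_distrib)

lemma bilinear_hat_lhd:
  "bilinear_product (hat_scale scale) (hat_space scale) (hat_lhd ne se sw nw)"
  unfolding bilinear_product_def hat_space_def
  by (auto simp: hat_simps upper.dual_space_iff product_add product_scale
      fun_eq_iff algebra_simps upper.scale_right_distrib)

text \<open>
  The axioms, oriented as a terminating rewrite system on the products of three elements.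
\<close>

lemma nested_product:
  "ne x (ne y z) = ne (ne x y) z + ne (se x y) z"
  "ne x (se y z) = se (ne x y) z"
  "ne (sw x y) z = ne (ne x y) z + ne (se x y) z - ne (nw x y) z"
  "se (se x y) z = se x (ne y z) + se x (se y z)"
  "se (nw x y) z = se x (ne y z) + se x (se y z)"
  "se (sw x y) z = se (ne x y) z"
  "sw x (sw y z) = sw x (ne y z)"
  "sw x (nw y z) = sw x (se y z)"
  "sw (sw x y) z = sw x (ne y z) - sw (nw x y) z"
  "sw (ne x y) z = ne x (sw y z) - sw (se x y) z"
  "nw x (nw y z) = nw x (ne y z) + nw x (se y z) - nw x (sw y z)"
  "nw (ne x y) z = ne x (nw y z)"
  "nw (se x y) z = se x (sw y z) + se x (nw y z)"
  "nw (sw x y) z = sw x (se y z)"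
  "nw (nw x y) z = nw x (ne y z) + nw x (se y z)"
  using upper.vd_vd[of x y z] upper.vd_dv[of x y z] upper.dv_dv[of x y z]
    lower.vd_vd[of x y z] lower.vd_dv[of x y z] lower.dv_dv[of x y z]
    nw_lhd[of x y z] sw_nw[of x y z] sw_sw[of x y z]
    se_nw[of x y z] ne_nw[of x y z] rhd_sw[of x y z]
    nw_se[of x y z] sw_se[of x y z] lhd_ne[of x y z]
  by (simp_all add: sum_product_def product_add algebra_simps)

text \<open>The first components give the axioms of the sub-adjacent dialgebra. The second, at a
  point, are signed sums of \<open>a\<close>, \<open>b\<close>, \<open>c\<close> at triple products;
  \<open>nested_product\<close> normalises the arguments, and the terms of each functional match
  separately.\<close>

lemma hat_dialgebra_axioms:
  assumes "u \<in> hat_space scale" "v \<in> hat_space scale" "w \<in> hat_space scale"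
  shows "hat_rhd ne se sw nw (hat_rhd ne se sw nw u v) w = hat_rhd ne se sw nw u (hat_rhd ne se sw nw v w)"
    "hat_lhd ne se sw nw (hat_lhd ne se sw nw u v) w = hat_lhd ne se sw nw u (hat_lhd ne se sw nw v w)"
    "hat_lhd ne se sw nw (hat_lhd ne se sw nw u v) w = hat_lhd ne se sw nw u (hat_rhd ne se sw nw v w)"
    "hat_lhd ne se sw nw (hat_rhd ne se sw nw u v) w = hat_rhd ne se sw nw u (hat_lhd ne se sw nw v w)"
    "hat_rhd ne se sw nw (hat_lhd ne se sw nw u v) w = hat_rhd ne se sw nw u (hat_rhd ne se sw nw v w)"
proof -
  obtain x a y b z c where uvw: "u = (x, a)" "v = (y, b)" "w = (z, c)"
    by (metis prod.exhaust)
  have abc: "a \<in> dual_space scale" "b \<in> dual_space scale" "c \<in> dual_space scale"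
    using assms by (simp_all add: uvw hat_space_def)
  note linear = abc[THEN upper.dual_space_linear(1)] abc[THEN upper.dual_space_linear(4)]
  show "hat_rhd ne se sw nw (hat_rhd ne se sw nw u v) w = hat_rhd ne se sw nw u (hat_rhd ne se sw nw v w)"
    by (simp add: uvw hat_simps fun_eq_iff product_add nested_product linear algebra_simps)
  show "hat_lhd ne se sw nw (hat_lhd ne se sw nw u v) w = hat_lhd ne se sw nw u (hat_lhd ne se sw nw v w)"
    by (simp add: uvw hat_simps fun_eq_iff product_add nested_product linear algebra_simps)
  show "hat_lhd ne se sw nw (hat_lhd ne se sw nw u v) w = hat_lhd ne se sw nw u (hat_rhd ne se sw nw v w)"
    by (simp add: uvw hat_simps fun_eq_iff product_add nested_product linear algebra_simps)
  show "hat_lhd ne se sw nw (hat_rhd ne se sw nw u v) w = hat_rhd ne se sw nw u (hat_lhd ne se sw nw v w)"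
    by (simp add: uvw hat_simps fun_eq_iff product_add nested_product linear algebra_simps)
  show "hat_rhd ne se sw nw (hat_lhd ne se sw nw u v) w = hat_rhd ne se sw nw u (hat_rhd ne se sw nw v w)"
    by (simp add: uvw hat_simps fun_eq_iff product_add nested_product linear algebra_simps)
qed

text \<open>The functional part of v \<rhd> w - v \<lhd> w at \<open>x\<close> collapses to
  \<open>c (se x y) - b (sw z x)\<close>. Hence both sides reduce to
  \<open>c (ne x y + se x y) + b (nw z x) + a (ne y z - sw y z)\<close>.\<close>

lemma hat_form_invariant:
  assumes "u \<in> hat_space scale" "v \<in> hat_space scale" "w \<in> hat_space scale"
  shows "hat_form w (hat_rhd ne se sw nw u v) = hat_form v (hat_lhd ne se sw nw w u) +
    hat_form u (hat_rhd ne se sw nw v w - hat_lhd ne se sw nw v w)"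
proof -
  obtain x a y b z c where uvw: "u = (x, a)" "v = (y, b)" "w = (z, c)"
    by (metis prod.exhaust)
  have abc: "a \<in> dual_space scale" "b \<in> dual_space scale" "c \<in> dual_space scale"
    using assms by (simp_all add: uvw hat_space_def)
  note linear = abc[THEN upper.dual_space_linear(1)] abc[THEN upper.dual_space_linear(4)]
  show ?thesis
    by (simp add: uvw hat_simps linear algebra_simps)
qed

end

section \<open>Dual bases of the double\<close>

locale dual_bases = vector_space scale
  for scale :: "'k::field_char_0 \<Rightarrow> 'v::ab_group_add \<Rightarrow> 'v" +
  fixes n :: nat and e :: "nat \<Rightarrow> 'v" and e_dual :: "nat \<Rightarrow> 'v \<Rightarrow> 'k"
  assumes span_e: "span (e ` {1..n}) = UNIV"
    and dual: "i \<in> {1..n} \<Longrightarrow> e_dual i \<in> dual_space scale"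
    and pairing: "\<lbrakk>i \<in> {1..n}; j \<in> {1..n}\<rbrakk> \<Longrightarrow> e_dual i (e j) = (if i = j then 1 else 0)"
begin

sublocale hat: vector_space "hat_scale scale"
  by (rule vector_space_hat_scale)

text \<open>The vectors equal to their expansion form a subspace. It contains each
  \<open>e j\<close>, where only the term with index \<open>j\<close> survives.\<close>

lemma expand_vector: "x = (\<Sum>i=1..n. scale (e_dual i x) (e i))"
proof -
  have "x \<in> span (e ` {1..n})" using span_e by simp
  then show ?thesis
  proof (induction x rule: span_induct)
    case base
    show ?case
      by (rule subspaceI)
        (auto simp: dual_space_linear[OF dual] scale_left_distrib sum.distrib
          simp flip: scale_scale scale_sum_right)
  next
    case (step x)
    then obtain j where j: "j \<in> {1..n}" "x = e j" by auto
    then have "(\<Sum>i=1..n. scale (e_dual i x) (e i)) = (\<Sum>i=1..n. if i = j then e i else 0)"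
      by (intro sum.cong) (auto simp: pairing)
    with j show ?case by simp
  qed
qed

lemma expand_form:
  assumes "a \<in> dual_space scale"
  shows "a x = (\<Sum>i=1..n. a (e i) * e_dual i x)"
  by (subst expand_vector) (simp add: dual_space_linear[OF assms] mult.commute)

text \<open>The disjoint index lets a single sum run through both kinds of terms of
  \<open>r\<close>: \<open>Inl\<close> for vectors, \<open>Inr\<close> for functionals.\<close>

definition hat_basis :: "nat + nat \<Rightarrow> 'v \<times> ('v \<Rightarrow> 'k)" where
  "hat_basis = case_sum (\<lambda>i. (e i, 0)) (\<lambda>i. (0, e_dual i))"

text \<open>The family dual to \<open>hat_basis\<close> under \<open>hat_form\<close>: the halves
  are exchanged, since vectors pair with functionals.\<close>

definition hat_cobasis :: "nat + nat \<Rightarrow> 'v \<times> ('v \<Rightarrow> 'k)" where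
  "hat_cobasis = case_sum (\<lambda>i. (0, e_dual i)) (\<lambda>i. (e i, 0))"

abbreviation hat_index :: "(nat + nat) set" where
  "hat_index \<equiv> {1..n} <+> {1..n}"

lemma hat_basis_in_hat_space:
  assumes "k \<in> hat_index"
  shows "hat_basis k \<in> hat_space scale" "hat_cobasis k \<in> hat_space scale"
  using assms dual by (auto simp: hat_basis_def hat_cobasis_def hat_space_def dual_space_iff)

text \<open>Pairing \<open>(x, a)\<close> with \<open>(0, e_dual i)\<close> reads off
  \<open>e_dual i x\<close>, and with \<open>(e i, 0)\<close> it reads off \<open>a (e i)\<close>.
  So the components are \<open>expand_vector\<close> and \<open>expand_form\<close>.\<close>

lemma hat_expand:
  assumes "v \<in> hat_space scale"
  shows "v = (\<Sum>k\<in>hat_index. hat_scale scale (hat_form v (hat_cobasis k)) (hat_basis k))"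
    "v = (\<Sum>k\<in>hat_index. hat_scale scale (hat_form v (hat_basis k)) (hat_cobasis k))"
proof -
  obtain x a where v: "v = (x, a)" by (cases v)
  then have a: "a \<in> dual_space scale" using assms by (simp add: hat_space_def)
  have fst_sum: "fst (sum f I) = (\<Sum>i\<in>I. fst (f i))" and
    snd_sum: "snd (sum f I) u = (\<Sum>i\<in>I. snd (f i) u)"
    for f :: "nat \<Rightarrow> 'v \<times> ('v \<Rightarrow> 'k)" and I u
    by (induction I rule: infinite_finite_induct) auto
  note simps = v hat_basis_def hat_cobasis_def sum.Plus prod_eq_iff fun_eq_iff fst_sum snd_sum
    expand_vector[of x, symmetric] expand_form[OF a, symmetric] dual_space_linear[OF a]
    dual_space_linear[OF dual]
  show "v = (\<Sum>k\<in>hat_index. hat_scale scale (hat_form v (hat_cobasis k)) (hat_basis k))"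
    by (simp add: simps del: One_nat_def)
  show "v = (\<Sum>k\<in>hat_index. hat_scale scale (hat_form v (hat_basis k)) (hat_cobasis k))"
    by (simp add: simps del: One_nat_def)
qed

lemma finite_dimensional_hat_space: "fin_dim_space (hat_scale scale) (hat_space scale)"
proof
  show "hat.subspace (hat_space scale)"
    by (rule subspace_hat_space)
  have "hat.span (hat_basis ` hat_index) = hat_space scale"
  proof (rule subset_antisym)
    show "hat.span (hat_basis ` hat_index) \<subseteq> hat_space scale"
      using hat_basis_in_hat_space \<open>hat.subspace _\<close> by (intro hat.span_minimal image_subsetI)
    show "hat_space scale \<subseteq> hat.span (hat_basis ` hat_index)"
    proof
      fix v assume "v \<in> hat_space scale"
      from hat_expand(1)[OF this] show "v \<in> hat.span (hat_basis ` hat_index)"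
        by (rule ssubst) (auto intro!: hat.span_sum hat.span_scale intro: hat.span_base)
    qed
  qed
  then show "\<exists>B. finite B \<and> hat.span B = hat_space scale"
    by (intro exI[of _ "hat_basis ` hat_index"]) simp
qed

end

section \<open>The element \<open>r\<close> as the Casimir element of the double\<close>

theorem corollary4p14:
  fixes scale :: "'k::field_char_0 \<Rightarrow> 'v::ab_group_add \<Rightarrow> 'v"
    and ne se sw nw :: "'v \<Rightarrow> 'v \<Rightarrow> 'v"
    and n :: nat
    and e :: "nat \<Rightarrow> 'v"
    and e_dual :: "nat \<Rightarrow> 'v \<Rightarrow> 'k"
  assumes "pre_dialgebra scale UNIV ne se sw nw"
    and "inj_on e {1..n}"
    and "\<not> module.dependent scale (e ` {1..n})"
    and "module.span scale (e ` {1..n}) = UNIV"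
    and "\<And>i. i \<in> {1..n} \<Longrightarrow> e_dual i \<in> dual_space scale"
    and "\<And>i j. i \<in> {1..n} \<Longrightarrow> j \<in> {1..n} \<Longrightarrow> e_dual i (e j) = (if i = j then 1 else 0)"
  defines "r \<equiv> tensor_class (hat_scale scale) (hat_space scale) 2
      (\<Sum>i = 1..n. pure [(e i, 0), (0, e_dual i)] + pure [(0, e_dual i), (e i, 0)])"
  shows "dialgebra (hat_scale scale) (hat_space scale) (hat_rhd ne se sw nw) (hat_lhd ne se sw nw) \<and>
    symmetric_tensor r \<and>
    daybe_solution (hat_scale scale) (hat_space scale) (hat_rhd ne se sw nw) (hat_lhd ne se sw nw) r"
proof -
  interpret full_pre_dialgebra scale ne se sw nw
    using assms(1) by (rule full_pre_dialgebra.intro)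
  interpret dual_bases scale n e e_dual
    by unfold_locales (use assms in auto)
  interpret double: dialgebra "hat_scale scale" "hat_space scale" "hat_rhd ne se sw nw" "hat_lhd ne se sw nw"
    by (intro dialgebra.intro dialgebra_axioms.intro finite_dimensional_hat_space
        bilinear_hat_rhd bilinear_hat_lhd hat_dialgebra_axioms)
  let ?t = "\<Sum>i = 1..n. pure [(e i, 0), (0, e_dual i)] + pure [(0, e_dual i), (e i, 0)]
    :: ('v \<times> ('v \<Rightarrow> 'k)) list \<Rightarrow>\<^sub>0 'k"
  \<comment> \<open>Reversal exchanges the two terms with the same index, so the representative
    itself is fixed, not just its class.\<close>
  have "Poly_Mapping.map_key rev ?t = ?t"
    by (simp add: map_key_rev_sum map_key_rev_add map_key_rev_pure add.commute)
  then have "symmetric_tensor r"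
    unfolding r_def by (rule symmetric_tensor_classI)
  \<comment> \<open>The indices \<open>Inl i\<close> give the first term of each summand and
    \<open>Inr i\<close> the second.\<close>
  moreover have "?t = (\<Sum>k\<in>hat_index. pure [hat_basis k, hat_cobasis k])"
    by (simp add: sum.Plus hat_basis_def hat_cobasis_def sum.distrib)
  then have "daybe_solution (hat_scale scale) (hat_space scale)
      (hat_rhd ne se sw nw) (hat_lhd ne se sw nw) r"
    unfolding r_def
    by (simp only:) (intro double.daybe_solution_casimir[where \<omega> = hat_form]
      hat_basis_in_hat_space upper.linear_form_on_hat_form hat_form_sym hat_expand hat_form_invariant)
  ultimately show ?thesis
    using double.dialgebra_axioms by blast
qed

end
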